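(* In the fluid queue setting described in the context, if the positive random variables $\xi_n$, $n\ge1$, are independent of $W_0$, $Y_{\tau_n}$ and $\sum_{i=1}^{N_{\tau_n}^V}\eta_i$, then the distribution of $U$ is the convolution of the distribution of $W^-$ and the stationary residual life distribution of $\xi_1$.
   Context: Model. $(\Omega,\mathcal{F},\mathbb{P})$ is a complete probability space with a filtration $\{\mathcal{F}_t\}_{t\ge 0}$ satisfying the usual conditions; adaptedness, stopping times and martingales are with respect to it. Lévy processes have càdlàg paths. $X=\{X_t,t\ge0\}$ (cumulative fluid input) is a subordinator with $\mathbb{E}e^{-\theta X_t}=e^{t\phi(\theta)}$, $\phi(\theta)=-a\theta+\int_{\mathbb{R}_+}(e^{-\theta x}-1)\,\nu(dx)$, where $a\ge0$ and $\int_{\mathbb{R}_+}x\,\nu(dx)<\infty$. The server processes fluid at constant rate $r$. Set $Y_t=X_t-rt$, a spectrally positive Lévy process with exponent $\varphi(\theta)=\phi(\theta)+r\theta$, i.e. $\mathbb{E}e^{-\theta Y_t}=e^{t\varphi(\theta)}$. Standing assumptions: $\rho:=-\phi'(0)<r$ and $\mathbb{E}|Y_t|<\infty$ for all $t\ge0$ (so $\varphi'(0)=-\mathbb{E}Y_1=r-\rho>0$). The server fails at a strictly increasing sequence of stopping times $\{\tau_n,n\ge1\}$; the $n$th repair time $\xi_n$ is a positive $\mathcal{F}_{\tau_n}$-measurable random variable. Whenever the system becomes empty, the server takes a vacation; vacations continue until, on return, the server finds the system non-empty. The vacation starting times form a strictly increasing sequence of stopping times $\{\sigma_n,n\ge1\}$,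 and the $n$th vacation length $\eta_n$ is a positive $\mathcal{F}_{\sigma_n}$-measurable random variable. Let $W_0\ge0$ be $\mathcal{F}_0$-measurable. The virtual waiting time process is $$W_t=W_0+X_t-rt+\sum_{i=1}^{N_t^R}\xi_i+\sum_{i=1}^{N_t^V}\eta_i,\quad t\ge0,$$ (empty sums are zero), where $N_t^R=\sup\{n\mid\tau_n\le t\}$, $N_t^V=\sup\{n\mid\sigma_n\le t\}$ and $\sigma_n=\inf\{t\ge0\mid W_0+X_t-rt+\sum_{i=1}^{N_t^R}\xi_i+\sum_{i=1}^{n-1}\eta_i=0\}$, $n\ge1$. Steady-state setting. As $t\to\infty$, $W_t$ converges in distribution to a random variable $W$ and $t^{-1}\mathbb{E}W_t\to0$. The sequences $\{\xi_n\}$ and $\{\eta_n\}$ are positive and i.i.d. with $\mathbb{E}\xi_1<\infty$, $\mathbb{E}\eta_1<\infty$; $n^{-1}\tau_n\to\lambda_R^{-1}$ and $n^{-1}\sigma_n\to\lambda_V^{-1}$ in probability with $0<\lambda_R^{-1}<\infty$, $0<\lambda_V^{-1}<\infty$; $\{W_{\tau_k},k\ge1\}$ and $\{W_{\tau_k}-\xi_k,k\ge1\}$ are stationary and ergodic, with $(W_{\tau_k}-\xi_k,W_{\tau_k})$ converging in distribution to $(W^-,W^+)$ for proper random variables $W^-,W^+$; $\xi_n$ is independent of $\mathbf{1}_{\{N_1^R\ge n\}}$ and $\eta_n$ is independent of $\mathbf{1}_{\{N_1^V\ge n\}}$. Further notation. $U$ is a random variable with $\mathbb{E}e^{-\theta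 U}=\dfrac{\mathbb{E}e^{-\theta W^-}-\mathbb{E}e^{-\theta W^+}}{\theta\,\mathbb{E}\xi_1}$ for $\theta>0$, i.e. with density $\big(\mathbb{P}(W^+>x)-\mathbb{P}(W^->x)\big)/\mathbb{E}\xi_1$. The stationary residual life distribution of $\xi_1$ has density $\mathbb{P}(\xi_1>x)/\mathbb{E}\xi_1$ on $[0,\infty)$. *)

theory Defs
  imports "HOL-Probability.Probability"
begin

section \<open>Stochastic basis\<close>

text \<open>
  Time is the half-line \<open>{0..}\<close> inside \<^typ>\<open>real\<close>. The \<open>F t\<close> with \<open>t < 0\<close> are irrelevant: a filtration
  on \<open>{0..}\<close> extends by \<open>F t = F 0\<close>, and for a nonnegative \<open>T\<close> they affect neither
  \<^term>\<open>stopping_time F T\<close> nor \<open>pre_sigma T\<close>.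
\<close>

locale usual_filtration = prob_space M + complete_measure M + filtration "space M" F
  for M :: "'a measure" and F :: "real \<Rightarrow> 'a measure" +
  assumes F_sub: "\<And>t. 0 \<le> t \<Longrightarrow> sets (F t) \<subseteq> sets M"
    and F_null: "null_sets M \<subseteq> sets (F 0)"
    and F_right_cont: "\<And>t. 0 \<le> t \<Longrightarrow> sets (F t) = (\<Inter>s\<in>{t<..}. sets (F s))"

definition cadlag :: "(real \<Rightarrow> real) \<Rightarrow> bool" where
  "cadlag f \<longleftrightarrow> (\<forall>t\<ge>0. continuous (at_right t) f) \<and> (\<forall>t>0. \<exists>l. (f \<longlongrightarrow> l) (at_left t))"

context usual_filtration
begin

text \<open>Levy processes are taken relative to the filtration: adapted, with increments after \<open>s\<close>
  independent of \<open>F s\<close>.\<close>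

definition levy_process :: "(real \<Rightarrow> 'a \<Rightarrow> real) \<Rightarrow> bool" where
  "levy_process X \<longleftrightarrow>
     (\<forall>t\<ge>0. X t \<in> borel_measurable (F t)) \<and>
     (AE \<omega> in M. X 0 \<omega> = 0) \<and>
     (\<forall>s t. 0 \<le> s \<longrightarrow> s \<le> t \<longrightarrow>
        indep_set (sets (F s)) {(\<lambda>\<omega>. X t \<omega> - X s \<omega>) -` B \<inter> space M | B. B \<in> sets borel}) \<and>
     (\<forall>s t. 0 \<le> s \<longrightarrow> s \<le> t \<longrightarrow>
        distr M borel (\<lambda>\<omega>. X t \<omega> - X s \<omega>) = distr M borel (X (t - s))) \<and>
     (\<forall>\<omega>\<in>space M. cadlag (\<lambda>t. X t \<omega>))"

definition subordinator :: "(real \<Rightarrow> 'a \<Rightarrow> real) \<Rightarrow> bool" where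
  "subordinator X \<longleftrightarrow> levy_process X \<and> (AE \<omega> in M. mono_on {0..} (\<lambda>t. X t \<omega>))"

end

definition subordinator_exponent :: "real \<Rightarrow> real measure \<Rightarrow> real \<Rightarrow> real" where
  "subordinator_exponent a \<nu> \<theta> = - a * \<theta> + (\<integral>x. (exp (- \<theta> * x) - 1) \<partial>\<nu>)"


text \<open>Independence of two random variables with different value types, e.g. a number and a vector
  (\<^const>\<open>prob_space.indep_var\<close> forces a common type).\<close>

definition (in prob_space) indep_rvs ::
  "('a \<Rightarrow> 'c::topological_space) \<Rightarrow> ('a \<Rightarrow> 'd::topological_space) \<Rightarrow> bool" where
  "indep_rvs f g \<longleftrightarrow>
     indep_set {f -` A \<inter> space M | A. A \<in> sets borel} {g -` B \<inter> space M | B. B \<in> sets borel}"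


section \<open>Convergence, stationarity, ergodicity\<close>

text \<open>The limit \<open>Z'\<close> may live on another probability space \<open>Q\<close>.\<close>

definition conv_in_distribution ::
  "'a measure \<Rightarrow> ('i \<Rightarrow> 'a \<Rightarrow> 'c::topological_space) \<Rightarrow> 'b measure \<Rightarrow> ('b \<Rightarrow> 'c) \<Rightarrow> 'i filter \<Rightarrow> bool" where
  "conv_in_distribution M Z Q Z' G \<longleftrightarrow>
     (\<forall>f::'c \<Rightarrow> real. continuous_on UNIV f \<longrightarrow> bounded (range f) \<longrightarrow>
        ((\<lambda>i. \<integral>\<omega>. f (Z i \<omega>) \<partial>M) \<longlongrightarrow> (\<integral>\<omega>. f (Z' \<omega>) \<partial>Q)) G)"

definition conv_in_probability :: "'a measure \<Rightarrow> (nat \<Rightarrow> 'a \<Rightarrow> real) \<Rightarrow> real \<Rightarrow> bool" where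
  "conv_in_probability M Z c \<longleftrightarrow>
     (\<forall>\<epsilon>>0. (\<lambda>n. measure M {\<omega>\<in>space M. \<epsilon> < \<bar>Z n \<omega> - c\<bar>}) \<longlonglongrightarrow> 0)"

definition sequence_law :: "'a measure \<Rightarrow> (nat \<Rightarrow> 'a \<Rightarrow> real) \<Rightarrow> (nat \<Rightarrow> real) measure" where
  "sequence_law M Z = distr M (\<Pi>\<^sub>M n\<in>UNIV. borel) (\<lambda>\<omega> n. Z n \<omega>)"

definition shift :: "(nat \<Rightarrow> real) \<Rightarrow> nat \<Rightarrow> real" where
  "shift x = (\<lambda>n. x (Suc n))"

definition stationary_ergodic :: "'a measure \<Rightarrow> (nat \<Rightarrow> 'a \<Rightarrow> real) \<Rightarrow> bool" where
  "stationary_ergodic M Z \<longleftrightarrow>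
     (\<forall>n. Z n \<in> borel_measurable M) \<and>
     sequence_law M (\<lambda>n. Z (Suc n)) = sequence_law M Z \<and>
     (\<forall>A \<in> sets (\<Pi>\<^sub>M n\<in>(UNIV::nat set). (borel :: real measure)).
        shift -` A = A \<longrightarrow> measure (sequence_law M Z) A \<in> {0, 1})"


section \<open>The fluid queue\<close>

text \<open>
  The sequences \<open>\<tau>, \<xi>, \<sigma>, \<eta>\<close> are indexed from 1; their values at 0 are never used. If infinitely many
  \<open>T n \<omega>\<close> are at most \<open>t\<close>, the supremum is an unspecified number; in the steady-state setting below this
  happens only on a null set, since \<open>T n / n\<close> has a positive limit in probability.
\<close>

definition counting :: "(nat \<Rightarrow> 'a \<Rightarrow> real) \<Rightarrow> real \<Rightarrow> 'a \<Rightarrow> nat" where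
  "counting T t \<omega> = Sup {n. 1 \<le> n \<and> T n \<omega> \<le> t}"

definition net_input :: "(real \<Rightarrow> 'a \<Rightarrow> real) \<Rightarrow> real \<Rightarrow> real \<Rightarrow> 'a \<Rightarrow> real" where
  "net_input X r t \<omega> = X t \<omega> - r * t"

definition virtual_waiting_time ::
  "('a \<Rightarrow> real) \<Rightarrow> (real \<Rightarrow> 'a \<Rightarrow> real) \<Rightarrow> real \<Rightarrow> (nat \<Rightarrow> 'a \<Rightarrow> real) \<Rightarrow> (nat \<Rightarrow> 'a \<Rightarrow> real) \<Rightarrow>
   (nat \<Rightarrow> 'a \<Rightarrow> real) \<Rightarrow> (nat \<Rightarrow> 'a \<Rightarrow> real) \<Rightarrow> real \<Rightarrow> 'a \<Rightarrow> real" where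
  "virtual_waiting_time W0 X r \<tau> \<xi> \<sigma> \<eta> t \<omega> =
     W0 \<omega> + X t \<omega> - r * t + (\<Sum>i = 1..counting \<tau> t \<omega>. \<xi> i \<omega>) + (\<Sum>i = 1..counting \<sigma> t \<omega>. \<eta> i \<omega>)"

text \<open>
  A strictly increasing sequence in \<open>[0, \<infinity>]\<close> has finite terms, so the stopping times are real-valued.
  The infimum defining \<open>\<sigma> n\<close> is taken in \<^typ>\<open>ereal\<close>, where the infimum of the empty set is \<open>\<infinity>\<close>; thus
  \<open>vacation_start\<close> includes that the level 0 is reached. The derivative in \<open>rho\<close> is one-sided
  because the exponent need only be finite on \<open>{0..}\<close>.
\<close>

locale fluid_queue = usual_filtration M F
  for M :: "'a measure" and F :: "real \<Rightarrow> 'a measure" +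
  fixes X :: "real \<Rightarrow> 'a \<Rightarrow> real" and a :: real and \<nu> :: "real measure" and r \<rho> :: real
    and W0 :: "'a \<Rightarrow> real" and \<tau> \<xi> \<sigma> \<eta> :: "nat \<Rightarrow> 'a \<Rightarrow> real"
  assumes X_subordinator: "subordinator X"
    and drift_nonneg: "0 \<le> a"
    and levy_measure: "sets \<nu> = sets borel" "emeasure \<nu> {..0} = 0"
    and levy_measure_mean: "integrable \<nu> (\<lambda>x. x)"
    and X_laplace: "\<And>t \<theta>. 0 \<le> t \<Longrightarrow> 0 \<le> \<theta> \<Longrightarrow>
          expectation (\<lambda>\<omega>. exp (- \<theta> * X t \<omega>)) = exp (t * subordinator_exponent a \<nu> \<theta>)"
    and rho: "(subordinator_exponent a \<nu> has_real_derivative - \<rho>) (at 0 within {0..})"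
    and rho_less: "\<rho> < r"
    and Y_integrable: "\<And>t. 0 \<le> t \<Longrightarrow> integrable M (net_input X r t)"
    and W0_measurable: "W0 \<in> borel_measurable (F 0)"
    and W0_nonneg: "\<And>\<omega>. \<omega> \<in> space M \<Longrightarrow> 0 \<le> W0 \<omega>"
    and failure_stopping: "\<And>n. 1 \<le> n \<Longrightarrow> stopping_time F (\<tau> n)"
    and failure_nonneg: "\<And>n \<omega>. 1 \<le> n \<Longrightarrow> \<omega> \<in> space M \<Longrightarrow> 0 \<le> \<tau> n \<omega>"
    and failure_increasing: "\<And>n \<omega>. 1 \<le> n \<Longrightarrow> \<omega> \<in> space M \<Longrightarrow> \<tau> n \<omega> < \<tau> (Suc n) \<omega>"
    and repair_measurable: "\<And>n. 1 \<le> n \<Longrightarrow> \<xi> n \<in> borel_measurable (pre_sigma (\<tau> n))"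
    and repair_pos: "\<And>n \<omega>. 1 \<le> n \<Longrightarrow> \<omega> \<in> space M \<Longrightarrow> 0 < \<xi> n \<omega>"
    and vacation_start: "\<And>n \<omega>. 1 \<le> n \<Longrightarrow> \<omega> \<in> space M \<Longrightarrow>
          ereal (\<sigma> n \<omega>) = Inf (ereal ` {t. 0 \<le> t \<and>
            W0 \<omega> + X t \<omega> - r * t + (\<Sum>i = 1..counting \<tau> t \<omega>. \<xi> i \<omega>) + (\<Sum>i = 1..n - 1. \<eta> i \<omega>) = 0})"
    and vacation_stopping: "\<And>n. 1 \<le> n \<Longrightarrow> stopping_time F (\<sigma> n)"
    and vacation_increasing: "\<And>n \<omega>. 1 \<le> n \<Longrightarrow> \<omega> \<in> space M \<Longrightarrow> \<sigma> n \<omega> < \<sigma> (Suc n) \<omega>"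
    and vacation_measurable: "\<And>n. 1 \<le> n \<Longrightarrow> \<eta> n \<in> borel_measurable (pre_sigma (\<sigma> n))"
    and vacation_pos: "\<And>n \<omega>. 1 \<le> n \<Longrightarrow> \<omega> \<in> space M \<Longrightarrow> 0 < \<eta> n \<omega>"
begin

abbreviation "W \<equiv> virtual_waiting_time W0 X r \<tau> \<xi> \<sigma> \<eta>"

end

text \<open>
  The limits \<open>W\<close>, \<open>W\<^sup>-\<close>, \<open>W\<^sup>+\<close> matter only through their laws, so they are random variables on a probability
  space \<open>Q\<close> unrelated to \<open>M\<close>. The index shifts in \<open>pre_failure_stationary\<close>, \<open>post_failure_stationary\<close>
  let \<open>\<tau> 1\<close> be the first entry of the sequences.
\<close>

locale steady_fluid_queue = fluid_queue M F X a \<nu> r \<rho> W0 \<tau> \<xi> \<sigma> \<eta> + Q: prob_space Q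
  for M :: "'a measure" and F X a \<nu> r \<rho> W0 \<tau> \<xi> \<sigma> \<eta> and Q :: "'b measure" +
  fixes Winf Wminus Wplus :: "'b \<Rightarrow> real" and lamR lamV :: real
  assumes Winf_rv: "Winf \<in> borel_measurable Q"
    and Wminus_rv: "Wminus \<in> borel_measurable Q"
    and Wplus_rv: "Wplus \<in> borel_measurable Q"
    and W_conv: "conv_in_distribution M W Q Winf at_top"
    and W_integrable: "\<forall>\<^sub>F t in at_top. integrable M (W t)"
    and W_mean: "((\<lambda>t. expectation (W t) / t) \<longlongrightarrow> 0) at_top"
    and repair_indep: "indep_vars (\<lambda>_. borel) \<xi> {1..}"
    and repair_ident: "\<And>n. 1 \<le> n \<Longrightarrow> distr M borel (\<xi> n) = distr M borel (\<xi> 1)"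
    and repair_mean: "integrable M (\<xi> 1)"
    and vacation_indep: "indep_vars (\<lambda>_. borel) \<eta> {1..}"
    and vacation_ident: "\<And>n. 1 \<le> n \<Longrightarrow> distr M borel (\<eta> n) = distr M borel (\<eta> 1)"
    and vacation_mean: "integrable M (\<eta> 1)"
    and rates_pos: "0 < lamR" "0 < lamV"
    and failure_rate: "conv_in_probability M (\<lambda>n \<omega>. \<tau> n \<omega> / real n) (1 / lamR)"
    and vacation_rate: "conv_in_probability M (\<lambda>n \<omega>. \<sigma> n \<omega> / real n) (1 / lamV)"
    and post_failure_stationary:
      "stationary_ergodic M (\<lambda>k \<omega>. W (\<tau> (Suc k) \<omega>) \<omega>)"
    and pre_failure_stationary:
      "stationary_ergodic M (\<lambda>k \<omega>. W (\<tau> (Suc k) \<omega>) \<omega> - \<xi> (Suc k) \<omega>)"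
    and failure_conv:
      "conv_in_distribution M (\<lambda>k \<omega>. (W (\<tau> k \<omega>) \<omega> - \<xi> k \<omega>, W (\<tau> k \<omega>) \<omega>))
         Q (\<lambda>\<omega>. (Wminus \<omega>, Wplus \<omega>)) sequentially"
    and repair_indep_count:
      "\<And>n. 1 \<le> n \<Longrightarrow> indep_var borel (\<xi> n) borel (indicator {\<omega>. n \<le> counting \<tau> 1 \<omega>} :: 'a \<Rightarrow> real)"
    and vacation_indep_count:
      "\<And>n. 1 \<le> n \<Longrightarrow> indep_var borel (\<eta> n) borel (indicator {\<omega>. n \<le> counting \<sigma> 1 \<omega>} :: 'a \<Rightarrow> real)"


text \<open>Stationary residual life distribution of a law \<open>D\<close> on the positive half-line.\<close>

definition residual_life :: "real measure \<Rightarrow> real measure" where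
  "residual_life D =
     density lborel (\<lambda>x. ennreal (indicator {0..} x * measure D {x<..} / (\<integral>y. y \<partial>D)))"

end

theory Submission
  imports Defs
begin

text \<open>The reason is that in the steady state the waiting time \<open>W\<^sup>+\<close> just after a failure is
  distributed like \<open>W\<^sup>-\<close> plus an independent repair time. With \<open>L\<close> denoting Laplace
  transforms, this gives \<open>L W\<^sup>+ = L W\<^sup>- * L \<xi>\<close>, and the given transform of \<open>U\<close> becomes \<open>L W\<^sup>- (\<theta>) * (1 - L \<xi> (\<theta>)) / (\<theta> * E \<xi>)\<close>. The second factor is the
  transform of the residual life law (\<open>laplace_residual_life\<close>), the product is the transform of a
  convolution (\<open>laplace_convolution\<close>), and Laplace transforms determine laws
  (\<open>laplace_unique\<close>).

  The independence needs care. Just before failure \<open>n\<close> the waiting time also contains the repair times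
  \<open>\<xi> 1, \<dots>, \<xi> (n - 1)\<close>. That \<open>\<xi> n\<close> is independent of these, and separately of the initial workload, net
  input and vacations, does not make it independent of the sum of all of them. At the first failure,
  however, no earlier repair time is present (\<open>waiting_time_before_first_repair\<close>), and independence
  holds there (\<open>first_repair_indep\<close>). Stationarity of the waiting times at failures carries this to the
  limit: the laws of \<open>W\<^sup>-\<close> and \<open>W\<^sup>+\<close> are those of the waiting time before and after the first repair
  (\<open>Wminus_law\<close>, \<open>Wplus_law\<close>).

  Uniqueness for Laplace transforms on the positive axis is a statement about nonnegative variables, so
  it remains to see that the waiting time before the first repair is almost surely nonnegative
  (\<open>AE_waiting_time_before_first_repair_nonneg\<close>). The input only jumps upward, so a negative level could be
  reached only through an empty system, where a vacation starts and raises the level. Nonnegativity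
  of \<open>U\<close> is then forced by its transform.\<close>

section \<open>Uniqueness of Laplace transforms\<close>

text \<open>For \<open>x \<ge> 0\<close> the variable \<open>exp (- x)\<close> lies in \<open>[0, 1]\<close>, and the values of the Laplace transform at
  the natural numbers are its moments. The exponential series, integrated term by term, expresses its
  characteristic function through these moments, so its law is determined; taking \<open>- ln\<close> recovers
  the original law.\<close>

lemma laplace_unique_nonneg:
  fixes P P' :: "real measure"
  assumes P: "real_distribution P" "AE x in P. 0 \<le> x"
    and P': "real_distribution P'" "AE x in P'. 0 \<le> x"
    and eq: "\<And>n::nat. (\<integral>x. exp (- real n * x) \<partial>P) = (\<integral>x. exp (- real n * x) \<partial>P')"
  shows "P = P'"
proof -
  define c where "c t k = (\<i> * complex_of_real t) ^ k /\<^sub>R fact k" for t and k :: nat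
  \<comment> \<open>The dominating function is the constant \<open>exp \<bar>t\<bar>\<close>, since \<open>exp (- x) \<le> 1\<close>.\<close>
  have limit: "(\<lambda>N. \<Sum>k<N. c t k * complex_of_real (\<integral>x. exp (- real k * x) \<partial>R))
      \<longlonglongrightarrow> char (distr R borel (\<lambda>x. exp (- x))) t"
    if R: "real_distribution R" "AE x in R. 0 \<le> x" for R :: "real measure" and t
  proof -
    interpret R: real_distribution R by fact
    have summand: "(\<i> * complex_of_real (t * exp (- x))) ^ k /\<^sub>R fact k
        = c t k * complex_of_real (exp (- real k * x))" for x k
      by (simp add: c_def power_mult_distrib exp_of_nat_mult[symmetric] mult_ac flip: of_real_power)
    have int_k: "integrable R (\<lambda>x. exp (- real k * x))" for k
      by (rule R.integrable_const_bound[where B = 1]) (use R(2) in \<open>auto elim!: eventually_mono\<close>)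
    have "(\<lambda>N. \<integral>x. (\<Sum>k<N. c t k * complex_of_real (exp (- real k * x))) \<partial>R)
        \<longlonglongrightarrow> (\<integral>x. iexp (t * exp (- x)) \<partial>R)"
    proof (rule integral_dominated_convergence[where w = "\<lambda>_. exp \<bar>t\<bar>"])
      show "AE x in R. (\<lambda>N. \<Sum>k<N. c t k * complex_of_real (exp (- real k * x)))
          \<longlonglongrightarrow> iexp (t * exp (- x))"
        using exp_converges[of "\<i> * complex_of_real (t * exp (- x))" for x] unfolding summand sums_def by simp
      show "AE x in R. norm (\<Sum>k<N. c t k * complex_of_real (exp (- real k * x))) \<le> exp \<bar>t\<bar>" for N
        using R(2)
      proof eventually_elim
        case (elim x)
        have "norm (\<Sum>k<N. c t k * complex_of_real (exp (- real k * x))) \<le> (\<Sum>k<N. \<bar>t\<bar> ^ k /\<^sub>R fact k)"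
          by (rule sum_norm_le)
            (use elim in \<open>auto simp: c_def norm_mult norm_power intro!: divide_right_mono mult_left_le\<close>)
        also have "\<dots> \<le> exp \<bar>t\<bar>"
          unfolding exp_def by (rule sum_le_suminf) (auto intro: summable_exp)
        finally show ?case .
      qed
    qed auto
    moreover have "(\<integral>x. (\<Sum>k<N. c t k * complex_of_real (exp (- real k * x))) \<partial>R)
        = (\<Sum>k<N. c t k * complex_of_real (\<integral>x. exp (- real k * x) \<partial>R))" for N
      using int_k by (subst Bochner_Integration.integral_sum) (auto intro!: integrable_of_real simp del: of_real_exp)
    ultimately show ?thesis
      by (simp add: char_def integral_distr)
  qed
  interpret P: real_distribution P by fact
  interpret P': real_distribution P' by fact
  let ?Z = "\<lambda>x::real. exp (- x)"
  have "char (distr P borel ?Z) = char (distr P' borel ?Z)"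
    using limit[OF P] limit[OF P'] unfolding eq by (intro ext LIMSEQ_unique)
  then have "distr P borel ?Z = distr P' borel ?Z"
    by (intro Levy_uniqueness P.real_distribution_distr P'.real_distribution_distr) simp_all
  then have "distr (distr P borel ?Z) borel (\<lambda>y. - ln y) = distr (distr P' borel ?Z) borel (\<lambda>y. - ln y)"
    by simp
  then show ?thesis
    by (simp add: distr_distr o_def distr_id2)
qed

text \<open>Mass on the negative half-line makes the Laplace transform grow without bound: the inequality
  \<open>n * max 0 (- x) \<le> exp (- n * x)\<close> bounds the mean of the negative part by \<open>1 / n\<close>, for every \<open>n\<close>.\<close>

lemma AE_nonneg_of_laplace_le_1:
  fixes P :: "real measure"
  assumes P: "real_distribution P"
    and int: "\<And>n. integrable P (\<lambda>x. exp (- real (Suc n) * x))"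
    and le: "\<And>n. (\<integral>x. exp (- real (Suc n) * x) \<partial>P) \<le> 1"
  shows "AE x in P. 0 \<le> x"
proof -
  interpret P: real_distribution P by fact
  have bound: "real (Suc n) * max 0 (- x) \<le> exp (- real (Suc n) * x)" for n x
  proof -
    have "real (Suc n) * max 0 (- x) = max 0 (real (Suc n) * - x)"
      using max_mult_distrib_left[of "real (Suc n)" 0 "- x"] by simp
    also have "\<dots> \<le> exp (- real (Suc n) * x)"
      using exp_ge_add_one_self[of "- real (Suc n) * x"] by (intro max.boundedI) (simp_all del: of_nat_Suc)
    finally show ?thesis .
  qed
  have int_neg: "integrable P (\<lambda>x. max 0 (- x))"
    by (rule Bochner_Integration.integrable_bound[OF int[of 0]]) (use bound[of 0] in auto)
  have small: "(\<integral>x. max 0 (- x) \<partial>P) \<le> 1 / real (Suc n)" for n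
  proof -
    have "real (Suc n) * (\<integral>x. max 0 (- x) \<partial>P) = (\<integral>x. real (Suc n) * max 0 (- x) \<partial>P)"
      by simp
    also have "\<dots> \<le> (\<integral>x. exp (- real (Suc n) * x) \<partial>P)"
      by (intro integral_mono int bound integrable_mult_right int_neg)
    finally show ?thesis using le[of n] by (simp add: field_simps)
  qed
  have "(\<integral>x. max 0 (- x) \<partial>P) \<le> 0"
    by (rule LIMSEQ_le_const[OF lim_1_over_n[THEN LIMSEQ_Suc]]) (use small in auto)
  moreover have "0 \<le> (\<integral>x. max 0 (- x) \<partial>P)" by (rule integral_nonneg_AE) auto
  ultimately have "AE x in P. max 0 (- x) = 0"
    using integral_nonneg_eq_0_iff_AE[OF int_neg] by auto
  then show ?thesis by eventually_elim (auto simp: max_def split: if_splits)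
qed

text \<open>That the first law is carried by the nonnegative half-line as well follows from the agreement of the
  transforms: the transform of the second law is positive, so the left-hand integral is
  not the default value \<open>0\<close> of a non-integrable function, and it is at most \<open>1\<close>, which leaves no
  mass on the negative half-line.\<close>

theorem laplace_unique:
  fixes P P' :: "real measure"
  assumes P: "real_distribution P" and P': "real_distribution P'" "AE x in P'. 0 \<le> x"
    and eq: "\<And>\<theta>. 0 < \<theta> \<Longrightarrow> (\<integral>x. exp (- \<theta> * x) \<partial>P) = (\<integral>x. exp (- \<theta> * x) \<partial>P')"
  shows "P = P'"
proof -
  interpret P: real_distribution P by fact
  interpret P': real_distribution P' by fact
  have int': "integrable P' (\<lambda>x. exp (- \<theta> * x))" if "0 < \<theta>" for \<theta>
    by (rule P'.integrable_const_bound[where B = 1])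
      (use P'(2) that in \<open>auto elim!: eventually_mono\<close>)
  have pos: "0 < (\<integral>x. exp (- \<theta> * x) \<partial>P')" if "0 < \<theta>" for \<theta>
    using P'.expectation_greater[OF int'[OF that], of 0] by simp
  have le: "(\<integral>x. exp (- \<theta> * x) \<partial>P') \<le> 1" if "0 < \<theta>" for \<theta>
  proof -
    have "(\<integral>x. exp (- \<theta> * x) \<partial>P') \<le> (\<integral>x. 1 \<partial>P')"
      by (rule integral_mono_AE[OF int'[OF that]]) (use P'(2) that in \<open>auto elim!: eventually_mono\<close>)
    then show ?thesis using P'.prob_space by simp
  qed
  have "AE x in P. 0 \<le> x"
  proof (rule AE_nonneg_of_laplace_le_1[OF P])
    fix n
    show "integrable P (\<lambda>x. exp (- real (Suc n) * x))"
      using pos[of "real (Suc n)"] eq[of "real (Suc n)"]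
        not_integrable_integral_eq[of P "\<lambda>x. exp (- real (Suc n) * x)"] by fastforce
    show "(\<integral>x. exp (- real (Suc n) * x) \<partial>P) \<le> 1"
      using le[of "real (Suc n)"] eq[of "real (Suc n)"] by simp
  qed
  moreover have "(\<integral>x. exp (- real n * x) \<partial>P) = (\<integral>x. exp (- real n * x) \<partial>P')" for n
    using eq[of "real n"] P.prob_space P'.prob_space by (cases n) auto
  ultimately show ?thesis using laplace_unique_nonneg[OF P _ P'] by blast
qed

section \<open>The residual life distribution\<close>

text \<open>Writing the tail \<open>measure D {x<..}\<close> as an integral over \<open>D\<close> and exchanging the order of
  integration turns every residual life integral into an integral over \<open>D\<close> of primitives.\<close>

lemma nn_integral_residual_life:
  assumes D: "real_distribution D"
    and mean: "0 < (\<integral>y. y \<partial>D)"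
    and f[measurable]: "f \<in> borel_measurable borel"
  shows "(\<integral>\<^sup>+x. f x \<partial>residual_life D)
    = (\<integral>\<^sup>+y. (\<integral>\<^sup>+x. f x * indicator {0..<y} x \<partial>lborel) \<partial>D) / ennreal (\<integral>y. y \<partial>D)"
proof -
  interpret D: real_distribution D by fact
  interpret pair_sigma_finite lborel D ..
  have tail[measurable]: "(\<lambda>x. measure D {x<..}) \<in> borel_measurable borel"
  proof -
    have "measure D {x<..} = 1 - cdf D x" for x
      using D.prob_compl[of "{..x}"] by (simp add: cdf_def Compl_atMost flip: Compl_eq_Diff_UNIV)
    moreover have "cdf D \<in> borel_measurable borel"
      by (rule borel_measurable_mono) (simp add: mono_def D.cdf_nondecreasing)
    ultimately show ?thesis by simp
  qed
  have joint[measurable]: "(\<lambda>(x, y). f x * indicator {0..<y} x) \<in> borel_measurable (lborel \<Otimes>\<^sub>M D)"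
    unfolding indicator_def atLeastLessThan_iff by measurable
  have "(\<integral>\<^sup>+x. f x \<partial>residual_life D)
      = (\<integral>\<^sup>+x. (\<integral>\<^sup>+y. f x * indicator {0..<y} x \<partial>D) / ennreal (\<integral>y. y \<partial>D) \<partial>lborel)"
    unfolding residual_life_def
  proof (subst nn_integral_density; (simp; fail)?; intro nn_integral_cong)
    fix x :: real
    have "(\<integral>\<^sup>+y. f x * indicator {0..<y} x \<partial>D) = (\<integral>\<^sup>+y. (f x * indicator {0..} x) * indicator {x<..} y \<partial>D)"
      by (intro nn_integral_cong) (auto split: split_indicator)
    also have "\<dots> = f x * indicator {0..} x * ennreal (measure D {x<..})"
      by (simp add: nn_integral_cmult_indicator D.emeasure_eq_measure)
    finally show "ennreal (indicator {0..} x * measure D {x<..} / (\<integral>y. y \<partial>D)) * f x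
        = (\<integral>\<^sup>+y. f x * indicator {0..<y} x \<partial>D) / ennreal (\<integral>y. y \<partial>D)"
      using mean by (simp add: divide_ennreal[symmetric] ennreal_mult ennreal_times_divide mult_ac ennreal_indicator)
  qed
  also have "\<dots> = (\<integral>\<^sup>+x. (\<integral>\<^sup>+y. f x * indicator {0..<y} x \<partial>D) \<partial>lborel) / ennreal (\<integral>y. y \<partial>D)"
    using D.borel_measurable_nn_integral[OF joint] by (intro nn_integral_divide) simp
  also have "(\<integral>\<^sup>+x. (\<integral>\<^sup>+y. f x * indicator {0..<y} x \<partial>D) \<partial>lborel)
      = (\<integral>\<^sup>+y. (\<integral>\<^sup>+x. f x * indicator {0..<y} x \<partial>lborel) \<partial>D)"
    using Fubini[OF joint] by simp
  finally show ?thesis .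
qed

lemma nn_integral_laplace_residual_life:
  assumes D: "real_distribution D" "AE y in D. 0 < y"
    and mean: "0 < (\<integral>y. y \<partial>D)" and \<theta>: "0 < \<theta>"
  shows "(\<integral>\<^sup>+x. exp (- \<theta> * x) \<partial>residual_life D)
    = ennreal ((1 - (\<integral>y. exp (- \<theta> * y) \<partial>D)) / (\<theta> * (\<integral>y. y \<partial>D)))"
proof -
  interpret D: real_distribution D by fact
  have int: "integrable D (\<lambda>y. exp (- \<theta> * y))"
    by (rule D.integrable_const_bound[where B = 1]) (use D(2) \<theta> in \<open>auto elim!: eventually_mono\<close>)
  have "(\<integral>\<^sup>+y. (\<integral>\<^sup>+x. ennreal (exp (- \<theta> * x)) * indicator {0..<y} x \<partial>lborel) \<partial>D)
      = (\<integral>\<^sup>+y. ennreal ((1 - exp (- \<theta> * y)) / \<theta>) \<partial>D)"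
  proof (rule nn_integral_cong_AE, use D(2) in eventually_elim)
    case (elim y)
    have "(\<integral>\<^sup>+x. ennreal (exp (- \<theta> * x)) * indicator {0..<y} x \<partial>lborel)
        = (\<integral>\<^sup>+x. ennreal (exp (- \<theta> * x)) * indicator {0..y} x \<partial>lborel)"
      using AE_lborel_singleton[of y]
      by (intro nn_integral_cong_AE) (auto elim!: eventually_mono split: split_indicator)
    also have "\<dots> = - exp (- \<theta> * y) / \<theta> - - exp (- \<theta> * 0) / \<theta>"
      using elim \<theta> by (intro nn_integral_FTC_Icc) (auto intro!: derivative_eq_intros)
    finally show ?case by (simp add: diff_divide_distrib)
  qed
  also have "\<dots> = ennreal (\<integral>y. (1 - exp (- \<theta> * y)) / \<theta> \<partial>D)"
    using D(2) \<theta> int by (intro nn_integral_eq_integral) (auto elim!: eventually_mono)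
  also have "(\<integral>y. (1 - exp (- \<theta> * y)) / \<theta> \<partial>D) = (1 - (\<integral>y. exp (- \<theta> * y) \<partial>D)) / \<theta>"
    using int D.prob_space by simp
  finally have "(\<integral>\<^sup>+y. (\<integral>\<^sup>+x. ennreal (exp (- \<theta> * x)) * indicator {0..<y} x \<partial>lborel) \<partial>D)
      = ennreal ((1 - (\<integral>y. exp (- \<theta> * y) \<partial>D)) / \<theta>)" .
  moreover have "(\<integral>y. exp (- \<theta> * y) \<partial>D) \<le> 1"
    by (rule D.integral_le_const[OF int]) (use D(2) \<theta> in \<open>auto elim!: eventually_mono\<close>)
  ultimately show ?thesis
    using mean \<theta> by (simp add: nn_integral_residual_life[OF D(1) mean] divide_ennreal)
qed

lemma real_distribution_residual_life:
  assumes D: "real_distribution D" "AE y in D. 0 < y" "integrable D (\<lambda>y. y)"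
    and mean: "0 < (\<integral>y. y \<partial>D)"
  shows "real_distribution (residual_life D)"
proof -
  interpret D: real_distribution D by fact
  have "emeasure (residual_life D) (space (residual_life D)) = (\<integral>\<^sup>+x. 1 \<partial>residual_life D)"
    by simp
  also have "\<dots> = (\<integral>\<^sup>+y. (\<integral>\<^sup>+x. 1 * indicator {0..<y} x \<partial>lborel) \<partial>D) / ennreal (\<integral>y. y \<partial>D)"
    by (rule nn_integral_residual_life[OF D(1) mean]) simp
  also have "(\<integral>\<^sup>+y. (\<integral>\<^sup>+x. 1 * indicator {0..<y} x \<partial>lborel) \<partial>D) = (\<integral>\<^sup>+y. ennreal y \<partial>D)"
    by (rule nn_integral_cong_AE, use D(2) in eventually_elim) simp
  also have "\<dots> = ennreal (\<integral>y. y \<partial>D)"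
    using D(2,3) by (intro nn_integral_eq_integral) (auto elim!: eventually_mono)
  also have "\<dots> / ennreal (\<integral>y. y \<partial>D) = 1"
    using mean by (simp add: divide_ennreal)
  finally have "prob_space (residual_life D)" by (rule prob_spaceI)
  then show ?thesis
    by (simp add: real_distribution_def real_distribution_axioms_def residual_life_def)
qed

lemma AE_residual_life_nonneg:
  assumes D: "real_distribution D" and mean: "0 < (\<integral>y. y \<partial>D)"
  shows "AE x in residual_life D. 0 \<le> x"
proof -
  have "emeasure (residual_life D) {..<0} = (\<integral>\<^sup>+x. indicator {..<0} x \<partial>residual_life D)"
    by (simp add: residual_life_def)
  also have "\<dots> = (\<integral>\<^sup>+y. (\<integral>\<^sup>+x. indicator {..<0::real} x * indicator {0..<y} x \<partial>lborel) \<partial>D)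
      / ennreal (\<integral>y. y \<partial>D)"
    by (rule nn_integral_residual_life[OF D mean]) simp
  also have "(\<lambda>x y. indicator {..<0::real} x * indicator {0..<y} x :: ennreal) = (\<lambda>x y. 0)"
    by (auto split: split_indicator)
  finally show ?thesis
    by (intro AE_I[of _ _ "{..<0}"]) (auto simp: residual_life_def not_le)
qed

lemma laplace_residual_life:
  assumes D: "real_distribution D" "AE y in D. 0 < y"
    and mean: "0 < (\<integral>y. y \<partial>D)" and \<theta>: "0 < \<theta>"
  shows "(\<integral>x. exp (- \<theta> * x) \<partial>residual_life D)
    = (1 - (\<integral>y. exp (- \<theta> * y) \<partial>D)) / (\<theta> * (\<integral>y. y \<partial>D))"
proof -
  interpret D: real_distribution D by fact
  have "(\<integral>y. exp (- \<theta> * y) \<partial>D) \<le> 1"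
    by (rule D.integral_le_const, rule D.integrable_const_bound[where B = 1])
      (use D(2) \<theta> in \<open>auto elim!: eventually_mono\<close>)
  then show ?thesis
    using mean \<theta> nn_integral_laplace_residual_life[OF assms]
    by (subst integral_eq_nn_integral) (simp_all add: residual_life_def)
qed

section \<open>Convolution and nonnegative laws\<close>

lemma real_distribution_convolution:
  assumes "real_distribution P" "real_distribution R"
  shows "real_distribution (P \<star> R)"
proof -
  interpret P: real_distribution P by fact
  interpret R: real_distribution R by fact
  interpret PR: pair_prob_space P R ..
  have "prob_space (P \<star> R)"
    unfolding convolution_def by (rule PR.prob_space_distr) simp
  then show ?thesis by (simp add: real_distribution_def real_distribution_axioms_def)
qed

lemma AE_convolution_nonneg:
  fixes P R :: "real measure"
  assumes P: "real_distribution P" "AE x in P. 0 \<le> x"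
    and R: "real_distribution R" "AE y in R. 0 \<le> y"
  shows "AE z in P \<star> R. 0 \<le> z"
proof -
  interpret P: real_distribution P by fact
  interpret R: real_distribution R by fact
  have "emeasure (P \<star> R) {..<0} = (\<integral>\<^sup>+x. \<integral>\<^sup>+y. indicator {..<0} (x + y) \<partial>R \<partial>P)"
    by (rule convolution_emeasure') (simp_all add: P.finite_measure_axioms R.finite_measure_axioms)
  also have "\<dots> = (\<integral>\<^sup>+x. 0 \<partial>P)"
  proof (rule nn_integral_cong_AE, use P(2) in eventually_elim)
    case (elim x)
    have "(\<integral>\<^sup>+y. indicator {..<0} (x + y) \<partial>R) = (\<integral>\<^sup>+y. 0 \<partial>R)"
      by (rule nn_integral_cong_AE, use R(2) in eventually_elim) (use elim in simp)
    then show ?case by simp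
  qed
  finally show ?thesis
    by (intro AE_I[of _ _ "{..<0}"]) auto
qed

text \<open>The factorisation is carried out in \<^typ>\<open>ennreal\<close>. It passes to Bochner integrals because \<open>enn2real\<close>
  is multiplicative also at \<open>\<infinity>\<close>, which it sends to \<open>0\<close>, the integral of a non-integrable function.\<close>

lemma laplace_convolution:
  fixes P R :: "real measure"
  assumes "real_distribution P" "real_distribution R"
  shows "(\<integral>z. exp (- \<theta> * z) \<partial>(P \<star> R)) = (\<integral>x. exp (- \<theta> * x) \<partial>P) * (\<integral>y. exp (- \<theta> * y) \<partial>R)"
proof -
  interpret P: real_distribution P by fact
  interpret R: real_distribution R by fact
  have "(\<integral>\<^sup>+z. exp (- \<theta> * z) \<partial>(P \<star> R)) = (\<integral>\<^sup>+x. \<integral>\<^sup>+y. ennreal (exp (- \<theta> * (x + y))) \<partial>R \<partial>P)"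
    by (rule nn_integral_convolution) (simp_all add: P.finite_measure_axioms R.finite_measure_axioms)
  also have "\<dots> = (\<integral>\<^sup>+x. ennreal (exp (- \<theta> * x)) * (\<integral>\<^sup>+y. exp (- \<theta> * y) \<partial>R) \<partial>P)"
  proof -
    have "exp (- \<theta> * (x + y)) = exp (- \<theta> * x) * exp (- \<theta> * y)" for x y
      by (simp add: distrib_left flip: exp_add)
    then show ?thesis by (simp add: ennreal_mult nn_integral_cmult)
  qed
  also have "\<dots> = (\<integral>\<^sup>+x. exp (- \<theta> * x) \<partial>P) * (\<integral>\<^sup>+y. exp (- \<theta> * y) \<partial>R)"
    by (rule nn_integral_multc) simp
  finally show ?thesis
    by (simp add: integral_eq_nn_integral enn2real_mult del: mult_minus_left)
qed

section \<open>Marginals of stationary sequences and their limits\<close>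

lemma conv_in_distribution_continuous_map:
  fixes h :: "'c::topological_space \<Rightarrow> 'd::topological_space"
  assumes conv: "conv_in_distribution M Z Q Z' G" and h: "continuous_on UNIV h"
  shows "conv_in_distribution M (\<lambda>i \<omega>. h (Z i \<omega>)) Q (\<lambda>\<omega>. h (Z' \<omega>)) G"
  unfolding conv_in_distribution_def
proof (intro allI impI)
  fix f :: "'d \<Rightarrow> real"
  assume f: "continuous_on UNIV f" "bounded (range f)"
  have "continuous_on UNIV (\<lambda>x. f (h x))"
    by (rule continuous_on_compose2[OF f(1) h]) simp
  moreover have "bounded (range (\<lambda>x. f (h x)))"
    by (rule bounded_subset[OF f(2)]) auto
  ultimately show "((\<lambda>i. \<integral>\<omega>. f (h (Z i \<omega>)) \<partial>M) \<longlongrightarrow> (\<integral>\<omega>. f (h (Z' \<omega>)) \<partial>Q)) G"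
    using conv unfolding conv_in_distribution_def by blast
qed

lemma char_distr_eq:
  assumes "prob_space M" and [measurable]: "Z \<in> borel_measurable M"
  shows "char (distr M borel Z) t
    = complex_of_real (\<integral>\<omega>. cos (t * Z \<omega>) \<partial>M) + \<i> * complex_of_real (\<integral>\<omega>. sin (t * Z \<omega>) \<partial>M)"
proof -
  interpret prob_space M by fact
  have "integrable M (\<lambda>\<omega>. cos (t * Z \<omega>))" "integrable M (\<lambda>\<omega>. sin (t * Z \<omega>))"
    by (auto intro!: integrable_const_bound[where B = 1])
  moreover have "iexp x = complex_of_real (cos x) + \<i> * complex_of_real (sin x)" for x
    by (simp add: complex_eq_iff Re_exp Im_exp)
  ultimately show ?thesis
    by (simp add: char_def integral_distr del: of_real_mult)
qed

text \<open>Convergence in distribution is tested on bounded continuous functions, among them \<open>cos (t * x)\<close> and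
  \<open>sin (t * x)\<close>; so the limit has the same characteristic function as the common law of the sequence.\<close>

lemma limit_law_of_identically_distributed:
  fixes Z :: "nat \<Rightarrow> 'a \<Rightarrow> real"
  assumes M: "prob_space M" and Q: "prob_space Q"
    and Z': "Z' \<in> borel_measurable Q" and Z0: "Z0 \<in> borel_measurable M"
    and Z: "\<forall>\<^sub>F k in sequentially. Z k \<in> borel_measurable M \<and> distr M borel (Z k) = distr M borel Z0"
    and conv: "conv_in_distribution M Z Q Z' sequentially"
  shows "distr Q borel Z' = distr M borel Z0"
proof -
  have eq: "(\<integral>\<omega>. f (Z' \<omega>) \<partial>Q) = (\<integral>\<omega>. f (Z0 \<omega>) \<partial>M)"
    if f: "continuous_on UNIV f" "bounded (range f)" for f :: "real \<Rightarrow> real"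
  proof -
    have [measurable]: "f \<in> borel_measurable borel"
      using f(1) by (rule borel_measurable_continuous_onI)
    have lim: "(\<lambda>k. \<integral>\<omega>. f (Z k \<omega>) \<partial>M) \<longlonglongrightarrow> (\<integral>\<omega>. f (Z' \<omega>) \<partial>Q)"
      using conv f unfolding conv_in_distribution_def by blast
    have ev: "\<forall>\<^sub>F k in sequentially. (\<integral>\<omega>. f (Z k \<omega>) \<partial>M) = (\<integral>\<omega>. f (Z0 \<omega>) \<partial>M)"
      using Z
    proof eventually_elim
      case (elim k)
      then have "(\<integral>\<omega>. f (Z k \<omega>) \<partial>M) = (\<integral>x. f x \<partial>distr M borel (Z k))"
        by (subst integral_distr) auto
      also have "\<dots> = (\<integral>\<omega>. f (Z0 \<omega>) \<partial>M)"
        using elim Z0 by (simp add: integral_distr)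
      finally show ?case .
    qed
    from ev have "(\<lambda>k. \<integral>\<omega>. f (Z k \<omega>) \<partial>M) \<longlonglongrightarrow> (\<integral>\<omega>. f (Z0 \<omega>) \<partial>M)"
      by (rule tendsto_eventually)
    with lim show ?thesis by (rule LIMSEQ_unique)
  qed
  have "(\<integral>\<omega>. cos (t * Z' \<omega>) \<partial>Q) = (\<integral>\<omega>. cos (t * Z0 \<omega>) \<partial>M)" for t
    by (rule eq[where f = "\<lambda>x. cos (t * x)"]) (auto intro!: continuous_intros boundedI[of _ 1])
  moreover have "(\<integral>\<omega>. sin (t * Z' \<omega>) \<partial>Q) = (\<integral>\<omega>. sin (t * Z0 \<omega>) \<partial>M)" for t
    by (rule eq[where f = "\<lambda>x. sin (t * x)"]) (auto intro!: continuous_intros boundedI[of _ 1])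
  ultimately have "char (distr Q borel Z') = char (distr M borel Z0)"
    by (intro ext) (simp add: char_distr_eq[OF M Z0] char_distr_eq[OF Q Z'])
  then show ?thesis
    by (intro Levy_uniqueness prob_space.real_distribution_distr M Q Z0 Z')
qed

lemma stationary_ergodic_identically_distributed:
  assumes "stationary_ergodic M Z"
  shows "distr M borel (Z n) = distr M borel (Z 0)"
proof (induction n)
  case (Suc n)
  have meas: "Z k \<in> borel_measurable M" for k
    using assms unfolding stationary_ergodic_def by blast
  have law: "sequence_law M (\<lambda>n. Z (Suc n)) = sequence_law M Z"
    using assms unfolding stationary_ergodic_def by blast
  have marginal: "distr (sequence_law M Y) borel (\<lambda>x. x n) = distr M borel (Y n)"
    if "\<And>n. Y n \<in> borel_measurable M" for Y
    unfolding sequence_law_def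
    by (subst distr_distr) (auto simp: o_def that intro!: measurable_PiM_single')
  have "distr M borel (Z (Suc n)) = distr (sequence_law M (\<lambda>n. Z (Suc n))) borel (\<lambda>x. x n)"
    by (rule marginal[symmetric]) (rule meas)
  also have "\<dots> = distr M borel (Z n)"
    unfolding law by (rule marginal) (rule meas)
  finally show ?case using Suc by simp
qed simp

section \<open>The waiting time before the first repair\<close>

text \<open>A path whose jumps are all upward cannot cross the level \<open>0\<close> downward without hitting it. At the
  infimum \<open>s\<close> of the times where the path is negative, right-continuity excludes a positive value, and
  a negative value at \<open>s\<close> is excluded because on the left of \<open>s\<close> the path is nonnegative and falls at most
  at rate \<open>r\<close>, or by the initial value if \<open>s = 0\<close>.\<close>

lemma zero_before_negative:
  fixes f :: "real \<Rightarrow> real"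
  assumes mono: "mono_on {0..} f" and right: "\<And>t. 0 \<le> t \<Longrightarrow> continuous (at_right t) f"
    and T: "0 \<le> T" "c + f T - r * T < 0" and start: "0 \<le> c + f 0"
  obtains t where "0 \<le> t" "t < T" "c + f t - r * t = 0"
proof -
  define g where "g t = c + f t - r * t" for t
  define S where "S = {t. 0 \<le> t \<and> g t < 0}"
  define s where "s = Inf S"
  have "T \<in> S" using T by (simp add: S_def g_def)
  have bdd: "bdd_below S" by (rule bdd_belowI[of _ 0]) (simp add: S_def)
  have "s \<le> T" unfolding s_def using \<open>T \<in> S\<close> bdd by (rule cInf_lower)
  moreover have "0 \<le> s"
    unfolding s_def using \<open>T \<in> S\<close> by (intro cInf_greatest) (auto simp: S_def)
  ultimately have s: "0 \<le> s" "s \<le> T" by simp_all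
  have before: "0 \<le> g u" if "0 \<le> u" "u < s" for u
  proof (rule ccontr)
    assume "\<not> 0 \<le> g u"
    then have "u \<in> S" using that by (simp add: S_def)
    then have "s \<le> u" unfolding s_def using bdd by (rule cInf_lower)
    then show False using that by simp
  qed
  have "0 \<le> g s"
  proof (cases "s = 0")
    case True then show ?thesis using start by (simp add: g_def)
  next
    case False
    have "((\<lambda>u. - r * (s - u)) \<longlongrightarrow> - r * (s - s)) (at_left s)"
      by (intro tendsto_intros)
    moreover have "\<forall>\<^sub>F u in at_left s. - r * (s - u) \<le> g s"
    proof -
      have "\<forall>\<^sub>F u in at_left s. u \<in> {0<..<s}"
        by (rule eventually_at_left_real) (use False s in simp)
      then show ?thesis
      proof eventually_elim
        case (elim u)
        then have "f u \<le> f s" by (intro mono_onD[OF mono]) auto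
        moreover have "0 \<le> g u" using elim by (intro before) auto
        ultimately show ?case by (simp add: g_def right_diff_distrib)
      qed
    qed
    ultimately have "- r * (s - s) \<le> g s"
      by (rule tendsto_upperbound) simp
    then show ?thesis by simp
  qed
  moreover have "\<not> 0 < g s"
  proof
    assume pos: "0 < g s"
    have "(g \<longlongrightarrow> g s) (at_right s)"
      unfolding g_def using right[OF s(1), unfolded continuous_within] by (intro tendsto_intros)
    then have "\<forall>\<^sub>F u in at_right s. 0 < g u"
      using pos by (rule order_tendstoD)
    then obtain b where b: "s < b" "\<And>u. s < u \<Longrightarrow> u < b \<Longrightarrow> 0 < g u"
      unfolding eventually_at_right_field by blast
    have "b \<le> u" if "u \<in> S" for u
    proof (rule ccontr)
      assume "\<not> b \<le> u"
      moreover have "s \<le> u" using that bdd unfolding s_def by (rule cInf_lower)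
      ultimately have "0 < g u" using b pos by (cases "u = s") auto
      then show False using that by (simp add: S_def)
    qed
    then have "b \<le> s" unfolding s_def using \<open>T \<in> S\<close> by (intro cInf_greatest) auto
    then show False using b by simp
  qed
  ultimately have "g s = 0" by simp
  moreover have "s \<noteq> T" using \<open>g s = 0\<close> T(2) by (auto simp: g_def)
  ultimately show ?thesis using that[of s] s by (simp add: g_def)
qed

context fluid_queue
begin

lemma failure_ge_first:
  assumes "1 \<le> n" "\<omega> \<in> space M" shows "\<tau> 1 \<omega> \<le> \<tau> n \<omega>" and "1 < n \<Longrightarrow> \<tau> 1 \<omega> < \<tau> n \<omega>"
proof -
  have *: "n = 1 \<or> \<tau> 1 \<omega> < \<tau> n \<omega>"
    using assms(1)
  proof (induction n rule: dec_induct)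
    case (step n) then show ?case using failure_increasing[OF step(1) assms(2)] by auto
  qed simp
  then show "\<tau> 1 \<omega> \<le> \<tau> n \<omega>" "1 < n \<Longrightarrow> \<tau> 1 \<omega> < \<tau> n \<omega>" by auto
qed

lemma counting_failure_before_first:
  assumes "\<omega> \<in> space M" "t < \<tau> 1 \<omega>" shows "counting \<tau> t \<omega> = 0"
proof -
  have "\<not> \<tau> n \<omega> \<le> t" if "1 \<le> n" for n
    using failure_ge_first(1)[OF that assms(1)] assms(2) by simp
  then have "{n. 1 \<le> n \<and> \<tau> n \<omega> \<le> t} = {}" by blast
  then show ?thesis by (simp add: counting_def Sup_nat_def)
qed

lemma counting_failure_at_first:
  assumes "\<omega> \<in> space M" shows "counting \<tau> (\<tau> 1 \<omega>) \<omega> = 1"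
proof -
  have "n = 1" if "1 \<le> n" "\<tau> n \<omega> \<le> \<tau> 1 \<omega>" for n
    using failure_ge_first(2)[OF that(1) assms] that by (cases "n = 1") auto
  then have "{n. 1 \<le> n \<and> \<tau> n \<omega> \<le> \<tau> 1 \<omega>} = {1}" by blast
  then show ?thesis by (simp add: counting_def)
qed

text \<open>Up to the first failure no repair time has been added yet. This is what makes the first failure
  special: the waiting time just before it is a function of the initial workload, the net
  input and the accumulated vacations alone.\<close>

lemma waiting_time_before_first_repair:
  assumes "\<omega> \<in> space M"
  shows "W (\<tau> 1 \<omega>) \<omega> - \<xi> 1 \<omega>
    = W0 \<omega> + net_input X r (\<tau> 1 \<omega>) \<omega> + (\<Sum>i = 1..counting \<sigma> (\<tau> 1 \<omega>) \<omega>. \<eta> i \<omega>)"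
  using assms counting_failure_at_first by (simp add: virtual_waiting_time_def net_input_def)

lemma vacation_increasing_le:
  assumes "1 \<le> m" "m \<le> n" "\<omega> \<in> space M" shows "\<sigma> m \<omega> \<le> \<sigma> n \<omega>"
  using assms(2)
proof (induction n rule: dec_induct)
  case (step n)
  then have "\<sigma> n \<omega> < \<sigma> (Suc n) \<omega>" using assms(1) by (intro vacation_increasing assms(3)) simp
  then show ?case using step by simp
qed simp

text \<open>If the level before the first repair were negative, the path with exactly the \<open>K\<close> vacations counted up
  to the first failure would hit \<open>0\<close> earlier, and then vacation \<open>Suc K\<close> would have started by the first
  failure as well. The assumption on \<open>m\<close> says that only finitely many vacations start by then, so that
  their count is a genuine maximum.\<close>

lemma waiting_time_before_first_repair_nonneg:
  assumes \<omega>: "\<omega> \<in> space M" and mono: "mono_on {0..} (\<lambda>t. X t \<omega>)" and X0: "X 0 \<omega> = 0"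
    and m: "1 \<le> m" "\<tau> 1 \<omega> < \<sigma> m \<omega>"
  shows "0 \<le> W (\<tau> 1 \<omega>) \<omega> - \<xi> 1 \<omega>"
proof (rule ccontr)
  define K where "K = counting \<sigma> (\<tau> 1 \<omega>) \<omega>"
  define c where "c = W0 \<omega> + (\<Sum>i = 1..K. \<eta> i \<omega>)"
  assume "\<not> ?thesis"
  then have neg: "c + X (\<tau> 1 \<omega>) \<omega> - r * \<tau> 1 \<omega> < 0"
    unfolding waiting_time_before_first_repair[OF \<omega>] by (simp add: net_input_def c_def K_def)
  have "0 \<le> (\<Sum>i = 1..K. \<eta> i \<omega>)"
    using vacation_pos[OF _ \<omega>] by (intro sum_nonneg less_imp_le) simp
  then have start: "0 \<le> c + X 0 \<omega>"
    using W0_nonneg[OF \<omega>] by (simp add: c_def X0)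
  have right: "continuous (at_right t) (\<lambda>t. X t \<omega>)" if "0 \<le> t" for t
    using X_subordinator \<omega> that unfolding subordinator_def levy_process_def cadlag_def by blast
  have "0 \<le> \<tau> 1 \<omega>" using \<omega> by (intro failure_nonneg) simp
  from zero_before_negative[OF mono right this neg start]
  obtain t where t: "0 \<le> t" "t < \<tau> 1 \<omega>" "c + X t \<omega> - r * t = 0" by blast
  have "ereal (\<sigma> (Suc K) \<omega>) \<le> ereal t"
  proof (subst vacation_start[OF _ \<omega>], simp, rule Inf_lower, rule imageI)
    show "t \<in> {t. 0 \<le> t \<and> W0 \<omega> + X t \<omega> - r * t + (\<Sum>i = 1..counting \<tau> t \<omega>. \<xi> i \<omega>)
        + (\<Sum>i = 1..Suc K - 1. \<eta> i \<omega>) = 0}"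
      using t counting_failure_before_first[OF \<omega> t(2)] by (simp add: c_def)
  qed
  then have mem: "Suc K \<in> {n. 1 \<le> n \<and> \<sigma> n \<omega> \<le> \<tau> 1 \<omega>}" using t by simp
  have "n < m" if "1 \<le> n" "\<sigma> n \<omega> \<le> \<tau> 1 \<omega>" for n
  proof (rule ccontr)
    assume "\<not> n < m"
    then have "\<sigma> m \<omega> \<le> \<sigma> n \<omega>" by (intro vacation_increasing_le m(1) \<omega>) simp
    then show False using m(2) that by simp
  qed
  then have "bdd_above {n. 1 \<le> n \<and> \<sigma> n \<omega> \<le> \<tau> 1 \<omega>}"
    by (intro bdd_aboveI[of _ m] less_imp_le) simp
  then have "Suc K \<le> K"
    using cSup_upper[OF mem] by (simp add: K_def counting_def)
  then show False by simp
qed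

text \<open>Only for \<open>0 \<le> t\<close> are the events of \<open>F t\<close> known to be events of \<open>M\<close>; those of negative times belong to
  \<open>F 0\<close> by monotonicity of the filtration.\<close>

lemma measurable_vacation:
  assumes n: "1 \<le> n" shows "\<sigma> n \<in> borel_measurable M"
proof (rule borel_measurableI_le)
  fix t
  have "{\<omega> \<in> space M. \<sigma> n \<omega> \<le> t} \<in> sets (F (max 0 t))"
    using stopping_timeD[OF vacation_stopping[OF n], of t] sets_F_mono[of t "max 0 t"]
    by (simp add: pred_def space_F subset_iff)
  then show "{\<omega> \<in> space M. \<sigma> n \<omega> \<le> t} \<in> sets M"
    using F_sub[of "max 0 t"] by auto
qed

end

context steady_fluid_queue
begin

text \<open>Vacations do not accumulate: if all \<open>\<sigma> n\<close> were at most \<open>m\<close>, then \<open>\<sigma> n / n\<close> would tend to \<open>0\<close>,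
  while it tends to the positive number \<open>1 / lamV\<close> in probability.\<close>

lemma AE_vacation_after: "AE \<omega> in M. \<exists>n\<ge>1. s \<omega> < \<sigma> n \<omega>"
proof -
  define N where "N m = {\<omega> \<in> space M. \<forall>n. \<sigma> (Suc n) \<omega> \<le> real m}" for m :: nat
  have [measurable]: "\<sigma> (Suc n) \<in> borel_measurable M" for n by (rule measurable_vacation) simp
  have N: "N m \<in> sets M" for m unfolding N_def by measurable
  have null: "prob (N m) = 0" for m
  proof -
    define \<epsilon> where "\<epsilon> = 1 / lamV / 2"
    have "\<epsilon> > 0" using rates_pos by (simp add: \<epsilon>_def)
    let ?B = "\<lambda>n. {\<omega> \<in> space M. \<epsilon> < \<bar>\<sigma> n \<omega> / real n - 1 / lamV\<bar>}"
    have lim: "(\<lambda>n. prob (?B n)) \<longlonglongrightarrow> 0"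
      using vacation_rate \<open>\<epsilon> > 0\<close> unfolding conv_in_probability_def by blast
    have "(\<lambda>n. real m / real n) \<longlonglongrightarrow> 0" by (rule lim_const_over_n)
    then have "\<forall>\<^sub>F n in sequentially. real m / real n < \<epsilon>"
      using \<open>\<epsilon> > 0\<close> by (rule order_tendstoD)
    then have "\<forall>\<^sub>F n in sequentially. prob (N m) \<le> prob (?B n)"
      using eventually_ge_at_top[of 1]
    proof eventually_elim
      case (elim n)
      have "N m \<subseteq> ?B n"
      proof
        fix \<omega> assume "\<omega> \<in> N m"
        then have \<omega>: "\<omega> \<in> space M" "\<sigma> (Suc (n - 1)) \<omega> \<le> real m"
          by (auto simp: N_def)
        then have "\<sigma> n \<omega> / real n \<le> real m / real n"
          using elim by (simp add: divide_right_mono)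
        then have "\<epsilon> < \<bar>\<sigma> n \<omega> / real n - 1 / lamV\<bar>"
          using elim(1) by (simp add: \<epsilon>_def)
        then show "\<omega> \<in> ?B n" using \<omega>(1) by simp
      qed
      moreover have "\<sigma> n \<in> borel_measurable M" using elim by (intro measurable_vacation) simp
      then have "?B n \<in> sets M" by measurable
      ultimately show ?case by (rule finite_measure_mono)
    qed
    then have "prob (N m) \<le> 0" by (rule tendsto_lowerbound[OF lim]) simp
    then show ?thesis by (simp add: measure_le_0_iff)
  qed
  have "AE \<omega> in M. \<forall>m. \<omega> \<notin> N m"
    unfolding AE_all_countable using null N
    by (intro allI AE_not_in) (simp add: null_sets_def emeasure_eq_measure)
  then show ?thesis
    using AE_space
  proof eventually_elim
    case (elim \<omega>)
    obtain m :: nat where m: "s \<omega> \<le> real m" using real_arch_simple by blast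
    have "\<omega> \<notin> N m" using elim by blast
    then obtain n where "real m < \<sigma> (Suc n) \<omega>" using elim by (auto simp: N_def not_le)
    then show ?case using m by (intro exI[of _ "Suc n"]) auto
  qed
qed

lemma AE_waiting_time_before_first_repair_nonneg: "AE \<omega> in M. 0 \<le> W (\<tau> 1 \<omega>) \<omega> - \<xi> 1 \<omega>"
proof -
  have "AE \<omega> in M. mono_on {0..} (\<lambda>t. X t \<omega>)" "AE \<omega> in M. X 0 \<omega> = 0"
    using X_subordinator unfolding subordinator_def levy_process_def by auto
  then show ?thesis
    using AE_vacation_after[of "\<tau> 1"] AE_space
  proof eventually_elim
    case (elim \<omega>)
    then obtain m where "1 \<le> m" "\<tau> 1 \<omega> < \<sigma> m \<omega>" by blast
    with elim show ?case by (intro waiting_time_before_first_repair_nonneg)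
  qed
qed

text \<open>The hypothesis concerns only the three summands of the waiting time before the first repair,
  whose sum is a continuous function of the triple.\<close>

lemma first_repair_indep:
  assumes "indep_rvs (\<xi> 1)
      (\<lambda>\<omega>. (W0 \<omega>, net_input X r (\<tau> 1 \<omega>) \<omega>, \<Sum>i = 1..counting \<sigma> (\<tau> 1 \<omega>) \<omega>. \<eta> i \<omega>))"
  shows "indep_var borel (\<lambda>\<omega>. W (\<tau> 1 \<omega>) \<omega> - \<xi> 1 \<omega>) borel (\<xi> 1)"
proof -
  have meas_xi: "\<xi> 1 \<in> borel_measurable M"
    using repair_indep by (auto simp: indep_vars_def2)
  have meas_W: "(\<lambda>\<omega>. W (\<tau> 1 \<omega>) \<omega> - \<xi> 1 \<omega>) \<in> borel_measurable M"
    using pre_failure_stationary by (auto simp: stationary_ergodic_def dest!: spec[of _ 0])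
  let ?V = "\<lambda>\<omega>. (W0 \<omega>, net_input X r (\<tau> 1 \<omega>) \<omega>, \<Sum>i = 1..counting \<sigma> (\<tau> 1 \<omega>) \<omega>. \<eta> i \<omega>)"
  let ?WW = "\<lambda>\<omega>. W (\<tau> 1 \<omega>) \<omega> - \<xi> 1 \<omega>"
  have preimage: "\<exists>C\<in>sets borel. ?WW -` B \<inter> space M = ?V -` C \<inter> space M" if "B \<in> sets borel" for B
  proof
    let ?h = "\<lambda>(x, y, z). x + y + z :: real"
    have "continuous_on UNIV ?h"
      by (auto simp: case_prod_unfold intro!: continuous_intros)
    then have "?h \<in> borel_measurable borel" by (rule borel_measurable_continuous_onI)
    from measurable_sets[OF this that] show "?h -` B \<in> sets borel" by simp
    show "?WW -` B \<inter> space M = ?V -` (?h -` B) \<inter> space M"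
      using waiting_time_before_first_repair by auto
  qed
  have ind: "prob (\<xi> 1 -` A \<inter> space M \<inter> (?V -` C \<inter> space M))
      = prob (\<xi> 1 -` A \<inter> space M) * prob (?V -` C \<inter> space M)"
    if "A \<in> sets borel" "C \<in> sets borel" for A C
    using assms that unfolding indep_rvs_def by (intro indep_setD) auto
  have "indep_set {?WW -` B \<inter> space M | B. B \<in> sets borel} {\<xi> 1 -` A \<inter> space M | A. A \<in> sets borel}"
  proof (rule indep_setI)
    fix a b assume "a \<in> {?WW -` B \<inter> space M | B. B \<in> sets borel}"
      "b \<in> {\<xi> 1 -` A \<inter> space M | A. A \<in> sets borel}"
    then obtain A B where ab: "a = ?WW -` B \<inter> space M" "b = \<xi> 1 -` A \<inter> space M"
      and AB: "A \<in> sets borel" "B \<in> sets borel" by blast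
    obtain C where C: "C \<in> sets borel" "a = ?V -` C \<inter> space M"
      using preimage[OF AB(2)] ab(1) by blast
    show "prob (a \<inter> b) = prob a * prob b"
      using ind[OF AB(1) C(1)] unfolding C(2)[symmetric] ab(2)[symmetric]
      by (simp add: mult.commute Int_commute)
  qed (use measurable_sets[OF meas_xi] measurable_sets[OF meas_W] in blast)+
  moreover have "Int_stable {f -` B \<inter> space M | B. B \<in> sets borel}" for f :: "'a \<Rightarrow> real"
  proof (rule Int_stableI, clarify)
    fix B C :: "real set" assume "B \<in> sets borel" "C \<in> sets borel"
    then show "\<exists>D. f -` B \<inter> space M \<inter> (f -` C \<inter> space M) = f -` D \<inter> space M \<and> D \<in> sets borel"
      by (intro exI[of _ "B \<inter> C"]) auto
  qed
  ultimately show ?thesis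
    unfolding indep_var_eq using meas_xi meas_W by (intro conjI indep_set_sigma_sets) auto
qed

text \<open>Both sequences are stationary, so the laws along them do not change and the limit
  laws are the laws at the first failure.\<close>

lemma Wminus_law: "distr Q borel Wminus = distr M borel (\<lambda>\<omega>. W (\<tau> 1 \<omega>) \<omega> - \<xi> 1 \<omega>)"
  and Wplus_law: "distr Q borel Wplus = distr M borel (\<lambda>\<omega>. W (\<tau> 1 \<omega>) \<omega>)"
proof -
  have law: "distr Q borel Z' = distr M borel (Z 1)"
    if st: "stationary_ergodic M (\<lambda>k. Z (Suc k))" and "Z' \<in> borel_measurable Q"
      and "conv_in_distribution M Z Q Z' sequentially" for Z Z'
  proof (rule limit_law_of_identically_distributed[OF prob_space_axioms Q.prob_space_axioms that(2) _ _ that(3)])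
    have meas: "Z (Suc k) \<in> borel_measurable M" for k
      using st by (simp add: stationary_ergodic_def)
    then show "Z 1 \<in> borel_measurable M" by simp
    have "distr M borel (Z (Suc k)) = distr M borel (Z 1)" for k
      using stationary_ergodic_identically_distributed[OF st, of k] by simp
    with meas show "\<forall>\<^sub>F k in sequentially. Z k \<in> borel_measurable M \<and> distr M borel (Z k) = distr M borel (Z 1)"
      unfolding eventually_sequentially by (metis One_nat_def Suc_le_D)
  qed
  show "distr Q borel Wminus = distr M borel (\<lambda>\<omega>. W (\<tau> 1 \<omega>) \<omega> - \<xi> 1 \<omega>)"
    using law[OF pre_failure_stationary Wminus_rv]
      conv_in_distribution_continuous_map[OF failure_conv continuous_on_fst[OF continuous_on_id]] by simp
  show "distr Q borel Wplus = distr M borel (\<lambda>\<omega>. W (\<tau> 1 \<omega>) \<omega>)"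
    using law[OF post_failure_stationary Wplus_rv]
      conv_in_distribution_continuous_map[OF failure_conv continuous_on_snd[OF continuous_on_id]] by simp
qed

end

section \<open>The law of U\<close>

theorem theorem6p2:
  fixes M :: "'a measure" and F :: "real \<Rightarrow> 'a measure"
    and X :: "real \<Rightarrow> 'a \<Rightarrow> real" and a :: real and \<nu> :: "real measure" and r \<rho> :: real
    and W0 :: "'a \<Rightarrow> real" and \<tau> \<xi> \<sigma> \<eta> :: "nat \<Rightarrow> 'a \<Rightarrow> real"
    and Q :: "'b measure" and Winf Wminus Wplus U :: "'b \<Rightarrow> real" and lamR lamV :: real
  assumes queue: "steady_fluid_queue M F X a \<nu> r \<rho> W0 \<tau> \<xi> \<sigma> \<eta> Q Winf Wminus Wplus lamR lamV"
    and U_rv: "U \<in> borel_measurable Q"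
    and U_laplace: "\<And>\<theta>. 0 < \<theta> \<Longrightarrow>
      (\<integral>\<omega>. exp (- \<theta> * U \<omega>) \<partial>Q) =
        ((\<integral>\<omega>. exp (- \<theta> * Wminus \<omega>) \<partial>Q) - (\<integral>\<omega>. exp (- \<theta> * Wplus \<omega>) \<partial>Q)) / (\<theta> * (\<integral>\<omega>. \<xi> 1 \<omega> \<partial>M))"
    and indep: "\<And>n. 1 \<le> n \<Longrightarrow>
      prob_space.indep_rvs M (\<xi> n)
        (\<lambda>\<omega>. (W0 \<omega>, net_input X r (\<tau> n \<omega>) \<omega>, \<Sum>i = 1..counting \<sigma> (\<tau> n \<omega>) \<omega>. \<eta> i \<omega>))"
  shows "distr Q borel U = convolution (distr Q borel Wminus) (residual_life (distr M borel (\<xi> 1)))"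
proof -
  interpret steady_fluid_queue M F X a \<nu> r \<rho> W0 \<tau> \<xi> \<sigma> \<eta> Q Winf Wminus Wplus lamR lamV
    by (rule queue)
  define P where "P = distr Q borel Wminus"
  define D where "D = distr M borel (\<xi> 1)"
  let ?pre = "\<lambda>\<omega>. W (\<tau> 1 \<omega>) \<omega> - \<xi> 1 \<omega>"
  have ind: "indep_var borel ?pre borel (\<xi> 1)"
    by (rule first_repair_indep) (rule indep, simp)
  then have pre: "?pre \<in> borel_measurable M" and xi: "\<xi> 1 \<in> borel_measurable M"
    by (auto simp: indep_var_eq)
  have P_law: "P = distr M borel ?pre"
    unfolding P_def by (rule Wminus_law)
  have "real_distribution P"
    unfolding P_def by (rule Q.real_distribution_distr) (rule Wminus_rv)
  have "real_distribution D"
    unfolding D_def by (rule real_distribution_distr) (rule xi)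
  have P_nonneg: "AE x in P. 0 \<le> x"
    unfolding P_law using AE_waiting_time_before_first_repair_nonneg
    by (subst AE_distr_iff[OF pre]) auto
  have xi_pos: "AE \<omega> in M. 0 < \<xi> 1 \<omega>"
    using repair_pos[of 1] by (intro AE_I2) simp
  then have D_pos: "AE y in D. 0 < y"
    unfolding D_def by (subst AE_distr_iff[OF xi]) auto
  have D_mean: "(\<integral>y. y \<partial>D) = expectation (\<xi> 1)"
    unfolding D_def using xi by (subst integral_distr) auto
  have D_int: "integrable D (\<lambda>y. y)"
    unfolding D_def using repair_mean by (subst integrable_distr_eq[OF xi]) auto
  have mean: "0 < (\<integral>y. y \<partial>D)"
    unfolding D_mean using expectation_greater[OF repair_mean, of 0] xi_pos by simp
  let ?R = "residual_life D"
  have R: "real_distribution ?R" "AE y in ?R. 0 \<le> y"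
    using \<open>real_distribution D\<close> D_pos D_int mean
    by (auto intro: real_distribution_residual_life AE_residual_life_nonneg)
  have sum_law: "distr Q borel Wplus = (P \<star> D)"
    using sum_indep_random_variable[OF ind pre xi] unfolding Wplus_law P_law D_def by simp
  have laplace_distr: "(\<integral>x. exp (- \<theta> * x) \<partial>distr Q borel Z) = (\<integral>\<omega>. exp (- \<theta> * Z \<omega>) \<partial>Q)"
    if "Z \<in> borel_measurable Q" for Z and \<theta> :: real
    using that by (subst integral_distr) auto
  have "distr Q borel U = (P \<star> ?R)"
  proof (rule laplace_unique)
    show "real_distribution (distr Q borel U)"
      by (rule Q.real_distribution_distr) (rule U_rv)
    show "real_distribution (P \<star> ?R)"
      by (intro real_distribution_convolution \<open>real_distribution P\<close> R)
    show "AE x in (P \<star> ?R). 0 \<le> x"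
      by (intro AE_convolution_nonneg \<open>real_distribution P\<close> P_nonneg R)
  next
    fix \<theta> :: real assume \<theta>: "0 < \<theta>"
    let ?L = "\<lambda>S. \<integral>x. exp (- \<theta> * x) \<partial>S"
    have "?L (distr Q borel U) = (?L P - ?L (P \<star> D)) / (\<theta> * (\<integral>y. y \<partial>D))"
      unfolding laplace_distr[OF U_rv] U_laplace[OF \<theta>] D_mean sum_law[symmetric]
      unfolding laplace_distr[OF Wplus_rv] P_def laplace_distr[OF Wminus_rv] ..
    also have "\<dots> = ?L P * ((1 - ?L D) / (\<theta> * (\<integral>y. y \<partial>D)))"
      unfolding laplace_convolution[OF \<open>real_distribution P\<close> \<open>real_distribution D\<close>]
      by (simp add: right_diff_distrib)
    also have "(1 - ?L D) / (\<theta> * (\<integral>y. y \<partial>D)) = ?L ?R"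
      by (rule laplace_residual_life[symmetric]) fact+
    also have "?L P * ?L ?R = ?L (P \<star> ?R)"
      by (rule laplace_convolution[symmetric]) fact+
    finally show "?L (distr Q borel U) = ?L (P \<star> ?R)" .
  qed
  then show ?thesis unfolding P_def D_def .
qed

end
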